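(* Partitions $\mu$ and $\nu$ of $n$ are rook equivalent if and only if $\mathcal{S}_\mu=\mathcal{S}_\nu$.
   Context: A partition is an infinite weakly decreasing sequence $\mu_1\ge\mu_2\ge\cdots$ of nonnegative integers with finitely many nonzero terms, identified with its Ferrers board. Two partitions are rook equivalent if for every $k\ge0$ they have the same number of placements of $k$ non-attacking rooks (no two in the same row or column). Row $i$ ($i\ge1$) of $\mu$ is salient if there exists $j>i$ with $i+\mu_i\ge j+\mu_j$. $\mathcal{S}_\mu$ is the multiset $\{i+\mu_i:\text{row } i\text{ is salient in }\mu\}$ (with multiplicity). *)

theory Defs
  imports Main "HOL-Library.Multiset"
begin

(* Rows and columns are counted from 0: the i-th row of a partition mu (i >= 1) has
   length mu (i - 1). *)

definition partition_of :: "nat \<Rightarrow> (nat \<Rightarrow> nat) \<Rightarrow> bool" where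
  "partition_of n \<mu> \<longleftrightarrow>
     antimono \<mu> \<and> finite {i. \<mu> i \<noteq> 0} \<and> (\<Sum>i | \<mu> i \<noteq> 0. \<mu> i) = n"

definition ferrers_board :: "(nat \<Rightarrow> nat) \<Rightarrow> (nat \<times> nat) set" where
  "ferrers_board \<mu> = {(i, j). j < \<mu> i}"

definition non_attacking :: "(nat \<times> nat) set \<Rightarrow> bool" where
  "non_attacking R \<longleftrightarrow>
     (\<forall>p\<in>R. \<forall>q\<in>R. p \<noteq> q \<longrightarrow> fst p \<noteq> fst q \<and> snd p \<noteq> snd q)"

definition rook_placements :: "(nat \<times> nat) set \<Rightarrow> nat \<Rightarrow> (nat \<times> nat) set set" where
  "rook_placements B k = {R. R \<subseteq> B \<and> finite R \<and> card R = k \<and> non_attacking R}"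

definition rook_equivalent :: "(nat \<Rightarrow> nat) \<Rightarrow> (nat \<Rightarrow> nat) \<Rightarrow> bool" where
  "rook_equivalent \<mu> \<nu> \<longleftrightarrow>
     (\<forall>k. card (rook_placements (ferrers_board \<mu>) k) = card (rook_placements (ferrers_board \<nu>) k))"

(* Suc i + mu i is i + mu_i for 1-based row numbers i. *)

definition salient :: "(nat \<Rightarrow> nat) \<Rightarrow> nat \<Rightarrow> bool" where
  "salient \<mu> i \<longleftrightarrow> (\<exists>j>i. Suc i + \<mu> i \<ge> Suc j + \<mu> j)"

definition salient_mset :: "(nat \<Rightarrow> nat) \<Rightarrow> nat multiset" where
  "salient_mset \<mu> = image_mset (\<lambda>i. Suc i + \<mu> i) (mset_set {i. salient \<mu> i})"

(* mset_set is empty on infinite sets and card is 0 on them; neither default is ever met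
   for a partition, since both sets involved are finite. *)

lemma finite_salient:
  assumes "partition_of n \<mu>"
  shows "finite {i. salient \<mu> i}"
proof (rule finite_subset)
  show "{i. salient \<mu> i} \<subseteq> {i. \<mu> i \<noteq> 0}"
    by (auto simp: salient_def)
  show "finite {i. \<mu> i \<noteq> 0}"
    using assms by (simp add: partition_of_def)
qed

lemma finite_rook_placements:
  assumes "partition_of n \<mu>"
  shows "finite (rook_placements (ferrers_board \<mu>) k)"
proof -
  have "ferrers_board \<mu> = Sigma {i. \<mu> i \<noteq> 0} (\<lambda>i. {..<\<mu> i})"
    by (auto simp: ferrers_board_def)
  then have "finite (ferrers_board \<mu>)"
    using assms by (simp add: partition_of_def)
  moreover have "rook_placements (ferrers_board \<mu>) k \<subseteq> Pow (ferrers_board \<mu>)"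
    by (auto simp: rook_placements_def)
  ultimately show ?thesis
    by (meson finite_Pow_iff finite_subset)
qed

end

theory Submission
  imports Defs "HOL-Computational_Algebra.Polynomial"
begin

text \<open>
  Goldman, Joichi and White: if \<open>r\<^sub>k\<close> is the number of placements of \<open>k\<close> rooks on \<open>\<mu>\<close> and \<open>\<mu>\<close> has
  at most \<open>N\<close> nonzero rows, then \<open>\<Sum>\<^sub>k r\<^sub>k x(x-1)\<dots>(x-N+k+1)\<close> is the product of the linear factors
  \<open>x + (i + \<mu>\<^sub>i) - N\<close> for \<open>i \<le> N\<close>. Falling factorials are linearly independent and polynomials have
  unique multisets of roots, so rook equivalence means equality of the multisets of all \<open>i + \<mu>\<^sub>i\<close>.
  Since \<open>i + \<mu>\<^sub>i\<close> increases by at most one from a row to the next, row \<open>i\<close> is not salient exactly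
  when it is the last row at which the value \<open>i + \<mu>\<^sub>i\<close> is attained; hence the nonsalient rows
  contribute every value from the minimum \<open>m\<close> on exactly once, and counting rows gives
  \<open>m = \<bar>S\<^sub>\<mu>\<bar> + 1\<close>. So the multiset of all \<open>i + \<mu>\<^sub>i\<close> and \<open>S\<^sub>\<mu>\<close> determine each other.
\<close>

section \<open>Rook numbers and the factorization theorem\<close>

text \<open>Rows keep their numbers when earlier ones are dropped, so inductions can strip the
  longest remaining row.\<close>

definition tail_board :: "(nat \<Rightarrow> nat) \<Rightarrow> nat \<Rightarrow> (nat \<times> nat) set" where
  "tail_board \<mu> i = {(a, b). i \<le> a \<and> b < \<mu> a}"

abbreviation tail_rooks :: "(nat \<Rightarrow> nat) \<Rightarrow> nat \<Rightarrow> nat \<Rightarrow> nat" where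
  "tail_rooks \<mu> i k \<equiv> card (rook_placements (tail_board \<mu> i) k)"

definition falling :: "int \<Rightarrow> nat \<Rightarrow> int" where
  "falling x l = (\<Prod>t<l. x - int t)"

lemma tail_board_0: "tail_board \<mu> 0 = ferrers_board \<mu>"
  by (simp add: tail_board_def ferrers_board_def)

lemma finite_tail_board:
  assumes "\<And>j. j \<ge> N \<Longrightarrow> \<mu> j = 0"
  shows "finite (tail_board \<mu> i)"
proof (rule finite_subset)
  show "tail_board \<mu> i \<subseteq> (SIGMA a:{..<N}. {..<\<mu> a})"
    using assms by (force simp: tail_board_def not_less[symmetric])
qed auto

lemma finite_placements:
  assumes "finite B"
  shows "finite (rook_placements B k)"
proof (rule finite_subset)
  show "rook_placements B k \<subseteq> Pow B"
    by (auto simp: rook_placements_def)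
qed (use assms in auto)

lemma rook_placements_0: "rook_placements B 0 = {{}}"
  by (auto simp: rook_placements_def non_attacking_def)

text \<open>Later rows are no longer than row \<open>i\<close>, so every rook below blocks exactly
  one cell of row \<open>i\<close>. This is where the Ferrers shape enters.\<close>

lemma placement_columns:
  assumes "R \<in> rook_placements (tail_board \<mu> (Suc i)) k" and "antimono \<mu>"
  shows "snd ` R \<subseteq> {..<\<mu> i}" and "card (snd ` R) = k"
proof -
  have "\<mu> a \<le> \<mu> i" if "Suc i \<le> a" for a
    using assms(2) that by (auto simp: monotone_def)
  then show "snd ` R \<subseteq> {..<\<mu> i}"
    using assms(1) by (fastforce simp: rook_placements_def tail_board_def)
  have "inj_on snd R"
    using assms(1) by (auto simp: rook_placements_def non_attacking_def inj_on_def)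
  then show "card (snd ` R) = k"
    using assms(1) by (simp add: card_image rook_placements_def)
qed

lemma tail_rooks_eq_0:
  assumes "antimono \<mu>" and "k > \<mu> i"
  shows "tail_rooks \<mu> (Suc i) k = 0"
proof -
  have False if R: "R \<in> rook_placements (tail_board \<mu> (Suc i)) k" for R
    using card_mono[OF _ placement_columns(1)[OF R assms(1)]] placement_columns(2)[OF R assms(1)]
      assms(2) by simp
  then have "rook_placements (tail_board \<mu> (Suc i)) k = {}"
    by blast
  then show ?thesis
    by simp
qed

text \<open>Either row \<open>i\<close> is empty, or it holds one rook and the other
  \<open>k\<close> rooks leave \<open>\<mu> i - k\<close> of its columns free.\<close>

lemma tail_rooks_Suc:
  assumes "antimono \<mu>" and fin: "finite (tail_board \<mu> (Suc i))"
  shows "tail_rooks \<mu> i (Suc k) =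
    tail_rooks \<mu> (Suc i) (Suc k) + (\<mu> i - k) * tail_rooks \<mu> (Suc i) k"
proof -
  define P where "P k = rook_placements (tail_board \<mu> (Suc i)) k" for k
  \<comment> \<open>\<open>Q\<close> pairs a placement below row \<open>i\<close> with a column it
    leaves free; \<open>ins\<close> adds the rook of row \<open>i\<close> there.\<close>
  define Q where "Q = (SIGMA R:P k. {..<\<mu> i} - snd ` R)"
  define ins where "ins = (\<lambda>(R, c). insert (i, c) R :: (nat \<times> nat) set)"
  have tail: "tail_board \<mu> i = tail_board \<mu> (Suc i) \<union> {i} \<times> {..<\<mu> i}"
    by (auto simp: tail_board_def Suc_le_eq le_less)
  have row: "(i, c) \<notin> R" if "R \<in> P k" for R k c
    using that by (auto simp: P_def rook_placements_def tail_board_def)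
  have finP: "finite (P k)" for k
    unfolding P_def using fin by (rule finite_placements)
  have "rook_placements (tail_board \<mu> i) (Suc k) = P (Suc k) \<union> ins ` Q"
  proof (intro equalityI subsetI)
    fix R assume R: "R \<in> rook_placements (tail_board \<mu> i) (Suc k)"
    show "R \<in> P (Suc k) \<union> ins ` Q"
    proof (cases "\<exists>c. (i, c) \<in> R")
      case False
      then show ?thesis
        using R unfolding P_def tail by (auto simp: rook_placements_def)
    next
      case True
      then obtain c where c: "(i, c) \<in> R" by blast
      define R' where "R' = R - {(i, c)}"
      have *: "fst p \<noteq> i \<and> snd p \<noteq> c" if "p \<in> R'" for p
        using that R c by (fastforce simp: rook_placements_def non_attacking_def R'_def)
      have "R' \<in> P k"
        using R c * unfolding P_def tail
        by (fastforce simp: rook_placements_def non_attacking_def R'_def)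
      moreover have "c \<in> {..<\<mu> i} - snd ` R'"
        using R c * by (auto simp: rook_placements_def tail_board_def)
      moreover have "R = ins (R', c)"
        using c by (auto simp: ins_def R'_def)
      ultimately show ?thesis
        unfolding Q_def by blast
    qed
  next
    fix R assume "R \<in> P (Suc k) \<union> ins ` Q"
    then show "R \<in> rook_placements (tail_board \<mu> i) (Suc k)"
    proof
      assume "R \<in> P (Suc k)"
      then show ?thesis
        unfolding P_def tail by (auto simp: rook_placements_def)
    next
      assume "R \<in> ins ` Q"
      then obtain R' c where R': "R' \<in> P k" "c < \<mu> i" "c \<notin> snd ` R'" "R = insert (i, c) R'"
        by (auto simp: Q_def ins_def)
      have "fst p \<noteq> i \<and> snd p \<noteq> c" if "p \<in> R'" for p
      proof
        show "fst p \<noteq> i"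
          using that row[OF R'(1)] by (cases p) auto
        show "snd p \<noteq> c"
          using that R'(3) by blast
      qed
      then have "non_attacking R"
        using R'(1,4) by (simp add: P_def rook_placements_def non_attacking_def) metis
      then show ?thesis
        using R'(1,2,4) row[OF R'(1)] unfolding P_def tail by (auto simp: rook_placements_def)
    qed
  qed
  moreover have "P (Suc k) \<inter> ins ` Q = {}"
  proof -
    have "ins x \<notin> P (Suc k)" for x
      using row by (cases x) (auto simp: ins_def)
    then show ?thesis by blast
  qed
  moreover have "inj_on ins Q"
  proof (rule inj_onI)
    fix x y assume xy: "x \<in> Q" "y \<in> Q" "ins x = ins y"
    obtain R c R' c' where [simp]: "x = (R, c)" "y = (R', c')"
      by (metis prod.exhaust)
    have eq: "insert (i, c) R = insert (i, c') R'" and "R \<in> P k" "R' \<in> P k"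
      using xy by (auto simp: ins_def Q_def)
    then have out: "(i, d) \<notin> R" "(i, d) \<notin> R'" for d
      using row by blast+
    have "(i, c) \<in> insert (i, c') R'"
      using eq by blast
    then have "c = c'"
      using out by simp
    moreover from this have "R = R'"
      using eq out by (simp add: insert_ident)
    ultimately show "x = y"
      by simp
  qed
  moreover have finQ: "finite Q"
    unfolding Q_def using finP by auto
  moreover have "card Q = (\<mu> i - k) * card (P k)"
  proof -
    have "card Q = (\<Sum>R\<in>P k. card ({..<\<mu> i} - snd ` R))"
      unfolding Q_def using finP by simp
    also have "\<dots> = (\<Sum>R\<in>P k. \<mu> i - k)"
    proof (rule sum.cong)
      fix R assume "R \<in> P k"
      then show "card ({..<\<mu> i} - snd ` R) = \<mu> i - k"
        using placement_columns[of R \<mu> i k] assms(1)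
        by (simp add: P_def card_Diff_subset finite_subset[of "snd ` R" "{..<\<mu> i}"])
    qed simp
    finally show ?thesis by simp
  qed
  ultimately show ?thesis
    using finP unfolding P_def[symmetric] by (simp add: card_Un_disjoint card_image)
qed

lemma tail_rooks_gt:
  assumes "antimono \<mu>" and "\<And>j. j \<ge> i + m \<Longrightarrow> \<mu> j = 0" and "k > m"
  shows "tail_rooks \<mu> i k = 0"
  using assms(2,3)
proof (induction m arbitrary: i k)
  case 0
  then have "tail_board \<mu> i = {}"
    by (auto simp: tail_board_def)
  then have "rook_placements (tail_board \<mu> i) k = {}"
    using 0 by (auto simp: rook_placements_def)
  then show ?case by simp
next
  case (Suc m)
  then obtain l where l: "k = Suc l" "l > m"
    by (metis Suc_lessE)
  have "finite (tail_board \<mu> (Suc i))"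
    using Suc.prems(1) by (rule finite_tail_board)
  moreover have "tail_rooks \<mu> (Suc i) k = 0" "tail_rooks \<mu> (Suc i) l = 0"
    using Suc.IH[of "Suc i"] Suc.prems l by simp_all
  ultimately show ?case
    using tail_rooks_Suc[OF assms(1)] l by simp
qed

lemma falling_Suc: "falling x (Suc l) = (x - int l) * falling x l"
  by (simp add: falling_def)

text \<open>Induction on the number \<open>m\<close> of remaining rows: restoring row
  \<open>i\<close> multiplies the sum by one linear factor.\<close>

lemma rook_factorization:
  assumes "antimono \<mu>" and "\<And>j. j \<ge> i + m \<Longrightarrow> \<mu> j = 0"
  shows "(\<Sum>k\<le>m. int (tail_rooks \<mu> i k) * falling x (m - k)) =
    (\<Prod>j<m. x + int (\<mu> (i + j) + Suc j) - int m)"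
  using assms(2)
proof (induction m arbitrary: i)
  case 0
  then show ?case
    by (simp add: rook_placements_0 falling_def)
next
  case (Suc m)
  let ?r = "\<lambda>k. int (tail_rooks \<mu> (Suc i) k)"
  have fin: "finite (tail_board \<mu> (Suc i))"
    using Suc.prems by (rule finite_tail_board)
  \<comment> \<open>Integer subtraction is not truncated; for \<open>k > \<mu> i\<close> the forms
    still agree because \<open>?r k\<close> is 0.\<close>
  have r: "int (tail_rooks \<mu> i (Suc k)) = ?r (Suc k) + (int (\<mu> i) - int k) * ?r k" for k
  proof (cases "k \<le> \<mu> i")
    case True
    then show ?thesis
      by (simp add: tail_rooks_Suc[OF assms(1) fin] of_nat_diff)
  next
    case False
    then show ?thesis
      using tail_rooks_eq_0[OF assms(1), of i k] tail_rooks_Suc[OF assms(1) fin, of k] by simp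
  qed
  \<comment> \<open>Only \<open>m\<close> rows remain after row \<open>i\<close>. Dropping this term
    gives both sums below the same range.\<close>
  have top: "?r (Suc m) = 0"
    using tail_rooks_gt[OF assms(1), of "Suc i" m "Suc m"] Suc.prems by simp
  have "(\<Sum>k\<le>Suc m. int (tail_rooks \<mu> i k) * falling x (Suc m - k)) =
      ?r 0 * falling x (Suc m) +
      (\<Sum>k\<le>m. (?r (Suc k) + (int (\<mu> i) - int k) * ?r k) * falling x (m - k))"
    by (simp only: sum.atMost_Suc_shift r diff_Suc_Suc diff_zero rook_placements_0)
  also have "\<dots> = (\<Sum>k\<le>Suc m. ?r k * falling x (Suc m - k)) +
      (\<Sum>k\<le>m. (int (\<mu> i) - int k) * ?r k * falling x (m - k))"
    by (simp only: sum.atMost_Suc_shift diff_Suc_Suc diff_zero)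
       (simp add: sum.distrib distrib_right)
  also have "\<dots> = (\<Sum>k\<le>m. ?r k * falling x (Suc m - k)) +
      (\<Sum>k\<le>m. (int (\<mu> i) - int k) * ?r k * falling x (m - k))"
    using top by simp
  \<comment> \<open>\<open>falling_Suc\<close> yields the factor \<open>x - (m - k)\<close>; adding
    \<open>\<mu> i - k\<close> cancels \<open>k\<close>, so the coefficient leaves the sum.\<close>
  also have "\<dots> = (\<Sum>k\<le>m. (x + int (\<mu> i) - int m) * (?r k * falling x (m - k)))"
    unfolding sum.distrib[symmetric]
    by (rule sum.cong) (auto simp: Suc_diff_le falling_Suc of_nat_diff algebra_simps)
  also have "\<dots> = (x + int (\<mu> i) - int m) *
      (\<Prod>j<m. x + int (\<mu> (Suc i + j) + Suc j) - int m)"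
    using Suc.IH[of "Suc i"] Suc.prems by (simp only: sum_distrib_left[symmetric])
  also have "\<dots> = (\<Prod>j<Suc m. x + int (\<mu> (i + j) + Suc j) - int (Suc m))"
    by (subst prod.lessThan_Suc_shift) (simp add: algebra_simps)
  finally show ?case .
qed

section \<open>Rook equivalence as equality of root multisets\<close>

text \<open>Evaluation at 0, 1, ..., \<open>N\<close> gives a triangular system: at
  \<open>int l\<close> all terms beyond \<open>l\<close> vanish and the diagonal entry is the
  factorial of \<open>l\<close>.\<close>

lemma falling_independent:
  fixes c d :: "nat \<Rightarrow> int"
  assumes eq: "\<And>x. (\<Sum>l\<le>N. c l * falling x l) = (\<Sum>l\<le>N. d l * falling x l)" and "l \<le> N"
  shows "c l = d l"
  using assms(2)
proof (induction l rule: less_induct)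
  case (less l)
  have zero: "falling (int l) t = 0" if "t > l" for t
    using that by (auto simp: falling_def)
  have split: "(\<Sum>t\<le>N. e t * falling (int l) t) =
      (\<Sum>t<l. e t * falling (int l) t) + e l * falling (int l) l" for e :: "nat \<Rightarrow> int"
  proof -
    have "(\<Sum>t\<le>N. e t * falling (int l) t) = (\<Sum>t\<le>l. e t * falling (int l) t)"
      using less.prems by (intro sum.mono_neutral_right) (auto simp: zero)
    then show ?thesis
      by (simp add: lessThan_Suc_atMost[symmetric])
  qed
  have "(\<Sum>t<l. c t * falling (int l) t) = (\<Sum>t<l. d t * falling (int l) t)"
    using less by (intro sum.cong) auto
  then have "c l * falling (int l) l = d l * falling (int l) l"
    using eq[of "int l"] unfolding split by simp
  moreover have "falling (int l) l \<noteq> 0"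
    by (auto simp: falling_def)
  ultimately show ?case
    by simp
qed

lemma linear_products_eq_iff:
  fixes A B :: "'a :: {idom, ring_char_0} multiset"
  shows "(\<forall>x. (\<Prod>a\<in>#A. x + a) = (\<Prod>b\<in>#B. x + b)) \<longleftrightarrow> A = B"
proof
  assume eq: "\<forall>x. (\<Prod>a\<in>#A. x + a) = (\<Prod>b\<in>#B. x + b)"
  define p where "p C = (\<Prod>a\<in>#C. [:a, 1:])" for C :: "'a multiset"
  have roots: "proots (p C) = image_mset uminus C" for C
  proof (induction C)
    case (add a C)
    have "p C \<noteq> 0"
      by (auto simp: p_def prod_mset_zero_iff)
    then show ?case
      using add proots_mult[of "[:a, 1:]" "p C"] by (simp add: p_def)
  qed (simp add: p_def)
  \<comment> \<open>In characteristic 0 equal polynomial functions come from equal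
    polynomials.\<close>
  have "poly (p A) = poly (p B)"
    using eq by (auto simp: p_def poly_prod_mset add.commute)
  then have "p A = p B"
    by (simp add: poly_eq_poly_eq_iff)
  then have "image_mset uminus (image_mset uminus A) = image_mset uminus (image_mset uminus B)"
    by (simp only: roots[symmetric])
  then show "A = B"
    by (simp add: multiset.map_comp comp_def)
qed simp

abbreviation row_values :: "(nat \<Rightarrow> nat) \<Rightarrow> nat \<Rightarrow> nat multiset" where
  "row_values \<mu> N \<equiv> image_mset (\<lambda>i. Suc i + \<mu> i) (mset_set {..<N})"

lemma rook_equivalent_iff_row_values:
  assumes mu: "antimono \<mu>" "\<And>j. j \<ge> N \<Longrightarrow> \<mu> j = 0"
    and nu: "antimono \<nu>" "\<And>j. j \<ge> N \<Longrightarrow> \<nu> j = 0"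
  shows "rook_equivalent \<mu> \<nu> \<longleftrightarrow> row_values \<mu> N = row_values \<nu> N"
proof -
  let ?r = "\<lambda>\<mu> k. card (rook_placements (ferrers_board \<mu>) k)"
  \<comment> \<open>Indexed by the degree \<open>l = N - k\<close>, as
    \<open>falling_independent\<close> requires.\<close>
  let ?f = "\<lambda>\<mu> x. \<Sum>l\<le>N. int (?r \<mu> (N - l)) * falling x l"
  have f: "?f \<kappa> x = (\<Prod>a\<in>#image_mset (\<lambda>v. int v - int N) (row_values \<kappa> N). x + a)"
    if "antimono \<kappa>" "\<And>j. j \<ge> N \<Longrightarrow> \<kappa> j = 0" for \<kappa> x
  proof -
    have "?f \<kappa> x = (\<Sum>k\<le>N. int (?r \<kappa> k) * falling x (N - k))"
      by (rule sum.reindex_bij_witness[of _ "\<lambda>k. N - k" "\<lambda>k. N - k"]) auto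
    also have "\<dots> = (\<Prod>j<N. x + int (\<kappa> j + Suc j) - int N)"
      using rook_factorization[of \<kappa> 0 N x] that by (simp add: tail_board_0)
    also have "\<dots> = (\<Prod>a\<in>#image_mset (\<lambda>v. int v - int N) (row_values \<kappa> N). x + a)"
      by (simp add: prod_unfold_prod_mset multiset.map_comp comp_def algebra_simps)
    finally show ?thesis .
  qed
  have "rook_equivalent \<mu> \<nu> \<longleftrightarrow> (\<forall>x. ?f \<mu> x = ?f \<nu> x)"
  proof
    assume eq: "\<forall>x. ?f \<mu> x = ?f \<nu> x"
    have "?r \<mu> k = ?r \<nu> k" for k
    proof (cases "k \<le> N")
      case True
      then show ?thesis
        using falling_independent[of "\<lambda>l. int (?r \<mu> (N - l))" N "\<lambda>l. int (?r \<nu> (N - l))" "N - k"] eq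
        by simp
    next
      case False
      then show ?thesis
        using tail_rooks_gt[of \<mu> 0 N k] tail_rooks_gt[of \<nu> 0 N k] mu nu
        by (simp add: tail_board_0)
    qed
    then show "rook_equivalent \<mu> \<nu>"
      by (simp add: rook_equivalent_def)
  qed (simp add: rook_equivalent_def)
  also have "\<dots> \<longleftrightarrow> image_mset (\<lambda>v. int v - int N) (row_values \<mu> N) =
      image_mset (\<lambda>v. int v - int N) (row_values \<nu> N)"
    using linear_products_eq_iff by (simp only: f[OF mu] f[OF nu])
  also have "\<dots> \<longleftrightarrow> row_values \<mu> N = row_values \<nu> N"
  proof
    assume "image_mset (\<lambda>v. int v - int N) (row_values \<mu> N) =
      image_mset (\<lambda>v. int v - int N) (row_values \<nu> N)"
    from arg_cong[OF this, of "image_mset (\<lambda>z. nat (z + int N))"]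
    show "row_values \<mu> N = row_values \<nu> N"
      by (simp only: multiset.map_comp comp_def diff_add_cancel nat_int)
  qed simp
  finally show ?thesis .
qed

section \<open>Salient rows\<close>

lemma salient_nonzero: "salient \<mu> i \<Longrightarrow> \<mu> i \<noteq> 0"
  by (auto simp: salient_def)

text \<open>Take the last row below \<open>N\<close> with value at most \<open>v\<close>. All later
  values exceed \<open>v\<close>, yet the next is at most one larger, so the value is
  \<open>v\<close>.\<close>

lemma last_row_with_value:
  assumes "antimono \<mu>" and "\<And>j. j \<ge> N \<Longrightarrow> \<mu> j = 0"
    and "i < N" and "Suc i + \<mu> i \<le> v" and "v \<le> N"
  shows "\<exists>j<N. \<not> salient \<mu> j \<and> Suc j + \<mu> j = v"
proof -
  define J where "J = {j. j < N \<and> Suc j + \<mu> j \<le> v}"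
  have J: "finite J" "J \<noteq> {}"
    using assms(3,4) by (auto simp: J_def)
  define j where "j = Max J"
  have j: "j < N" "Suc j + \<mu> j \<le> v"
    using Max_in[OF J] by (auto simp: J_def j_def)
  have gt: "Suc k + \<mu> k > v" if "k > j" for k
  proof (cases "k < N")
    case True
    have "k \<notin> J"
      using that Max_ge[OF J(1), of k] by (auto simp: j_def)
    then show ?thesis
      using True by (simp add: J_def)
  next
    \<comment> \<open>Rows from \<open>N\<close> on have value at least \<open>Suc N\<close>, which
      exceeds \<open>v\<close>.\<close>
    case False
    then show ?thesis
      using assms(5) by simp
  qed
  have "\<mu> (Suc j) \<le> \<mu> j"
    using assms(1) by (auto simp: monotone_def)
  then have "Suc j + \<mu> j = v"
    using gt[of "Suc j"] j(2) by simp
  moreover have "\<not> salient \<mu> j"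
    using gt j(2) unfolding salient_def by (meson le_trans not_less)
  ultimately show ?thesis
    using j(1) by blast
qed

text \<open>Values strictly increase along nonsalient rows, so none repeats, and
  \<open>last_row_with_value\<close> fills the interval.\<close>

lemma nonsalient_values:
  assumes "antimono \<mu>" and zero: "\<And>j. j \<ge> N \<Longrightarrow> \<mu> j = 0" and "\<mu> (N - 1) = 0" and "N > 0"
  shows "image_mset (\<lambda>i. Suc i + \<mu> i) (mset_set {i. i < N \<and> \<not> salient \<mu> i}) =
    mset_set {Min ((\<lambda>i. Suc i + \<mu> i) ` {..<N})..N}"
proof -
  let ?f = "\<lambda>i. Suc i + \<mu> i"
  let ?A = "{i. i < N \<and> \<not> salient \<mu> i}"
  define m where "m = Min (?f ` {..<N})"
  have ne: "finite (?f ` {..<N})" "?f ` {..<N} \<noteq> {}"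
    using assms(4) by auto
  have inj: "inj_on ?f ?A"
    by (rule linorder_inj_onI) (auto simp: salient_def not_le)
  have "?f ` ?A = {m..N}"
  proof (intro equalityI subsetI)
    fix v assume "v \<in> ?f ` ?A"
    then obtain i where i: "i < N" "\<not> salient \<mu> i" "v = ?f i" by blast
    have "?f i \<le> N"
    proof (cases "i = N - 1")
      case True
      then show ?thesis using assms(3,4) by simp
    next
      case False
      then have "i < N - 1"
        using i(1) by simp
      \<comment> \<open>Row \<open>N - 1\<close> has length 0, hence value \<open>N\<close>, and
        nonsalience of \<open>i\<close> bounds its value by that.\<close>
      then have "?f i < ?f (N - 1)"
        using i(2) unfolding salient_def by (meson not_le)
      then show ?thesis using assms(3,4) by simp
    qed
    then show "v \<in> {m..N}"
      using i Min_le[OF ne(1), of "?f i"] unfolding m_def by auto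
  next
    fix v assume v: "v \<in> {m..N}"
    obtain i where "i < N" "?f i = m"
      using Min_in[OF ne] unfolding m_def by auto
    then show "v \<in> ?f ` ?A"
      using last_row_with_value[OF assms(1) zero, of N i v] v by force
  qed
  then show ?thesis
    using image_mset_mset_set[OF inj] by (simp add: m_def)
qed

lemma row_values_decomposition:
  assumes "antimono \<mu>" and zero: "\<And>j. j \<ge> N \<Longrightarrow> \<mu> j = 0" and "\<mu> (N - 1) = 0" and "N > 0"
  defines "m \<equiv> Min (set_mset (row_values \<mu> N))"
  shows "row_values \<mu> N = salient_mset \<mu> + mset_set {m..N}"
    and "m = Suc (size (salient_mset \<mu>))"
proof -
  let ?f = "\<lambda>i. Suc i + \<mu> i"
  have "i < N" if "salient \<mu> i" for i
    using salient_nonzero[OF that] zero[of i] by (cases "i < N") simp_all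
  then have split: "{..<N} = {i. salient \<mu> i} \<union> {i. i < N \<and> \<not> salient \<mu> i}"
      and fin: "finite {i. salient \<mu> i}"
    by (auto intro: finite_subset[of _ "{..<N}"])
  have "mset_set {..<N} = mset_set {i. salient \<mu> i} + mset_set {i. i < N \<and> \<not> salient \<mu> i}"
    unfolding split by (rule mset_set_Union) (use fin in auto)
  moreover have "m = Min (?f ` {..<N})"
    by (simp add: m_def)
  ultimately show decomp: "row_values \<mu> N = salient_mset \<mu> + mset_set {m..N}"
    using nonsalient_values[OF assms(1-4)] by (simp only: salient_mset_def image_mset_union)
  have "N = ?f (N - 1)"
    using assms(3,4) by simp
  then have "m \<le> N"
    unfolding m_def using assms(4) by (intro Min_le) (simp_all add: image_eqI[of _ _ "N - 1"])
  \<comment> \<open>Counting rows on both sides; \<open>m \<le> N\<close> makes the truncated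
    difference solvable for \<open>m\<close>.\<close>
  moreover have "N = size (salient_mset \<mu>) + (Suc N - m)"
    using arg_cong[OF decomp, of size] by simp
  ultimately show "m = Suc (size (salient_mset \<mu>))"
    by simp
qed

text \<open>In either direction the two minima agree, read off from the row values or from the size
  of the salient multiset; then the common interval cancels or is added back.\<close>

lemma row_values_eq_iff_salient_mset_eq:
  assumes mu: "antimono \<mu>" "\<And>j. j \<ge> N \<Longrightarrow> \<mu> j = 0" "\<mu> (N - 1) = 0"
    and nu: "antimono \<nu>" "\<And>j. j \<ge> N \<Longrightarrow> \<nu> j = 0" "\<nu> (N - 1) = 0" and "N > 0"
  shows "row_values \<mu> N = row_values \<nu> N \<longleftrightarrow> salient_mset \<mu> = salient_mset \<nu>"
  using row_values_decomposition[OF mu \<open>N > 0\<close>] row_values_decomposition[OF nu \<open>N > 0\<close>]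
  by (metis add_right_cancel)

lemma partition_of_eventually_0:
  assumes "partition_of n \<mu>"
  shows "\<exists>N. \<forall>j\<ge>N. \<mu> j = 0"
proof -
  have "finite {i. \<mu> i \<noteq> 0}"
    using assms by (simp add: partition_of_def)
  then obtain N where "\<forall>i\<in>{i. \<mu> i \<noteq> 0}. i < N"
    using finite_nat_set_iff_bounded by blast
  then show ?thesis
    by (meson leD mem_Collect_eq)
qed

theorem theorem15:
  fixes \<mu> \<nu> :: "nat \<Rightarrow> nat" and n :: nat
  assumes "partition_of n \<mu>" and "partition_of n \<nu>"
  shows "rook_equivalent \<mu> \<nu> \<longleftrightarrow> salient_mset \<mu> = salient_mset \<nu>"
proof -
  obtain M M' where M: "\<forall>j\<ge>M. \<mu> j = 0" and M': "\<forall>j\<ge>M'. \<nu> j = 0"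
    using assms partition_of_eventually_0 by blast
  \<comment> \<open>The extra row ensures \<open>N > 0\<close> and a last counted row of length 0 in
    both partitions.\<close>
  define N where "N = Suc (max M M')"
  have anti: "antimono \<mu>" "antimono \<nu>"
    using assms by (simp_all add: partition_of_def)
  have zero: "j \<ge> N \<Longrightarrow> \<mu> j = 0" "j \<ge> N \<Longrightarrow> \<nu> j = 0" "\<mu> (N - 1) = 0" "\<nu> (N - 1) = 0" "N > 0" for j
    using M M' by (simp_all add: N_def)
  show ?thesis
    using rook_equivalent_iff_row_values[OF anti(1) zero(1) anti(2) zero(2)]
      row_values_eq_iff_salient_mset_eq[OF anti(1) zero(1,3) anti(2) zero(2,4,5)]
    by simp
qed

end
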